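(* Let $n\ge 3$ and let $\Psi:\mathcal{S}^n\to\mathcal{S}^n$ be a nontrivial radial Blaschke Minkowski homomorphism. Then there is a continuous operator $$\Psi:\underbrace{\mathcal{S}^n\times\cdots\times\mathcal{S}^n}_{n-1}\to\mathcal{S}^n$$ (denoted by the same symbol), symmetric in its arguments, such that for $L_1,\ldots,L_m\in\mathcal{S}^n$ and $\lambda_1,\ldots,\lambda_m\ge 0$, $$\Psi(\lambda_1L_1\,\tilde{+}\,\cdots\,\tilde{+}\,\lambda_mL_m)=\widetilde{\sum_{i_1,\ldots,i_{n-1}}}\lambda_{i_1}\cdots\lambda_{i_{n-1}}\,\Psi(L_{i_1},\ldots,L_{i_{n-1}}),$$ where the sum (over all $i_1,\ldots,i_{n-1}\in\{1,\ldots,m\}$) is with respect to radial Minkowski addition.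
   Context: $\mathcal{S}^n$ is the space of star bodies in $\mathbb{R}^n$, i.e. compact sets $L$, starshaped with respect to the origin, whose radial function $\rho(L,u)=\max\{\lambda\ge 0:\lambda u\in L\}$, $u\in S^{n-1}$, is continuous. $\mathcal{S}^n$ is endowed with the Hausdorff topology. The radial Minkowski combination is defined by $\rho(\lambda_1L_1\,\tilde{+}\,\lambda_2L_2,\cdot)=\lambda_1\rho(L_1,\cdot)+\lambda_2\rho(L_2,\cdot)$ ($\lambda_1,\lambda_2\ge 0$), and the radial Blaschke sum by $\rho^{n-1}(K\,\tilde{\#}\,L,\cdot)=\rho^{n-1}(K,\cdot)+\rho^{n-1}(L,\cdot)$. A radial Blaschke Minkowski homomorphism is a map $\Psi:\mathcal{S}^n\to\mathcal{S}^n$ such that (a) $\Psi$ is continuous; (b) $\Psi(K\,\tilde{\#}\,L)=\Psi K\,\tilde{+}\,\Psi L$ for all $K,L\in\mathcal{S}^n$; (c) $\Psi$ intertwines rotations, i.e. $\Psi(\vartheta L)=\vartheta\Psi L$ for all $L\in\mathcal{S}^n$ and all $\vartheta\in SO(n)$. The trivial one is the operator that maps every star body to the origin.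
   Formalization: The topology on star bodies is that of the radial Hausdorff metric (uniform distance of radial functions), in hypothesis and conclusion, instead of the Hausdorff topology of compact sets, for which the continuity of the mixed operator fails. *)

theory Defs
  imports "HOL-Analysis.Analysis"
begin

text \<open>For a star body the supremum is attained, so it is the maximum; see
  \<open>radial_attained\<close> below.\<close>

definition radial :: "(real^'n) set \<Rightarrow> real^'n \<Rightarrow> real" where
  "radial L u = Sup {t. 0 \<le> t \<and> t *\<^sub>R u \<in> L}"

definition star_bodies :: "(real^'n) set set" where
  "star_bodies = {L. compact L \<and> 0 \<in> L \<and> (\<forall>x\<in>L. closed_segment 0 x \<subseteq> L) \<and>
     continuous_on (sphere 0 1) (radial L)}"

text \<open>The star body with prescribed nonnegative continuous radial function \<open>f\<close>; only the
  values of \<open>f\<close> on the unit sphere matter.\<close>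

definition star_of :: "(real^'n \<Rightarrow> real) \<Rightarrow> (real^'n) set" where
  "star_of f = {t *\<^sub>R u | t u. norm u = 1 \<and> 0 \<le> t \<and> t \<le> f u}"

lemma star_bodies_iff:
  "L \<in> star_bodies \<longleftrightarrow> compact L \<and> 0 \<in> L \<and> (\<forall>x\<in>L. closed_segment 0 x \<subseteq> L) \<and>
     continuous_on (sphere 0 1) (radial L)"
  by (simp add: star_bodies_def)

lemma ray_compact:
  fixes L :: "(real^'n) set"
  assumes "compact L" "norm u = 1"
  shows "compact {t. 0 \<le> t \<and> t *\<^sub>R u \<in> L}"
proof -
  have "closed ({0..} \<inter> (\<lambda>t. t *\<^sub>R u) -` L)"
    using assms by (intro closed_Int closed_vimage) (auto intro: compact_imp_closed continuous_intros)
  moreover have "{0..} \<inter> (\<lambda>t. t *\<^sub>R u) -` L = {t. 0 \<le> t \<and> t *\<^sub>R u \<in> L}"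
    by auto
  moreover obtain B where B: "\<And>x. x \<in> L \<Longrightarrow> norm x \<le> B"
    using assms compact_imp_bounded bounded_iff by metis
  have "bounded {t. 0 \<le> t \<and> t *\<^sub>R u \<in> L}"
    unfolding bounded_iff using B assms by (intro exI[of _ B]) force
  ultimately show ?thesis
    by (simp add: compact_eq_bounded_closed)
qed

lemma radial_attained:
  assumes "L \<in> star_bodies" "norm u = 1"
  shows "0 \<le> radial L u" "radial L u *\<^sub>R u \<in> L"
    and "\<And>t. 0 \<le> t \<Longrightarrow> t *\<^sub>R u \<in> L \<Longrightarrow> t \<le> radial L u"
proof -
  let ?S = "{t. 0 \<le> t \<and> t *\<^sub>R u \<in> L}"
  have c: "compact ?S"
    using assms by (intro ray_compact) (auto simp: star_bodies_iff)
  have ne: "?S \<noteq> {}"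
    using assms by (auto simp: star_bodies_iff intro!: exI[of _ 0])
  have bd: "bdd_above ?S"
    using c by (simp add: bounded_imp_bdd_above compact_imp_bounded)
  have "radial L u \<in> ?S"
    unfolding radial_def using c ne bd by (intro closed_contains_Sup) (auto simp: compact_imp_closed)
  then show "0 \<le> radial L u" "radial L u *\<^sub>R u \<in> L" by auto
  show "\<And>t. 0 \<le> t \<Longrightarrow> t *\<^sub>R u \<in> L \<Longrightarrow> t \<le> radial L u"
    unfolding radial_def using bd by (intro cSup_upper) auto
qed

lemma star_body_in_iff:
  assumes "L \<in> star_bodies" "norm u = 1" "0 \<le> t"
  shows "t *\<^sub>R u \<in> L \<longleftrightarrow> t \<le> radial L u"
proof
  assume t: "t \<le> radial L u"
  let ?r = "radial L u"
  have seg: "closed_segment 0 (?r *\<^sub>R u) \<subseteq> L"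
    using radial_attained(2)[OF assms(1,2)] assms(1) by (auto simp: star_bodies_iff)
  show "t *\<^sub>R u \<in> L"
  proof (cases "?r = 0")
    case True
    then show ?thesis using t assms by (auto simp: star_bodies_iff)
  next
    case False
    then have "t *\<^sub>R u = (1 - t / ?r) *\<^sub>R 0 + (t / ?r) *\<^sub>R (?r *\<^sub>R u)"
      by simp
    moreover have "0 \<le> t / ?r" "t / ?r \<le> 1"
      using False t assms(3) by (auto simp: divide_simps)
    ultimately show ?thesis using seg unfolding closed_segment_def by blast
  qed
qed (use radial_attained(3) assms in auto)

lemma star_of_radial:
  assumes "L \<in> star_bodies"
  shows "star_of (radial L) = L"
proof
  show "star_of (radial L) \<subseteq> L"
    using star_body_in_iff[OF assms] by (auto simp: star_of_def)
  show "L \<subseteq> star_of (radial L)"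
  proof
    fix x assume x: "x \<in> L"
    obtain u where u: "norm u = 1" "x = norm x *\<^sub>R u"
    proof (cases "x = 0")
      case True
      obtain u :: "real^'a" where "norm u = 1"
        using vector_choose_size[of 1] by auto
      then show ?thesis using True that by auto
    next
      case False
      then show ?thesis using that[of "x /\<^sub>R norm x"] by auto
    qed
    then have "norm x \<le> radial L u"
      using star_body_in_iff[OF assms u(1), of "norm x"] x by simp
    then show "x \<in> star_of (radial L)"
      unfolding star_of_def using u norm_ge_zero by blast
  qed
qed

lemma radial_star_of:
  fixes f :: "real^'n \<Rightarrow> real"
  assumes "\<And>u. norm u = 1 \<Longrightarrow> 0 \<le> f u" and u: "norm u = 1"
  shows "radial (star_of f) u = f u"
proof -
  have "t \<le> f u" if t: "0 \<le> t" "t *\<^sub>R u \<in> star_of f" for t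
  proof -
    obtain s v where s: "t *\<^sub>R u = s *\<^sub>R v" "norm v = 1" "0 \<le> s" "s \<le> f v"
      using t by (auto simp: star_of_def)
    have "norm (t *\<^sub>R u) = norm (s *\<^sub>R v)" by (simp only: s(1))
    then have "t = s" using s(2,3) u t(1) by (simp only: norm_scaleR abs_of_nonneg mult_1_right)
    then show ?thesis using s assms by (cases "t = 0") auto
  qed
  moreover have "t *\<^sub>R u \<in> star_of f" if "0 \<le> t" "t \<le> f u" for t
    unfolding star_of_def using that u by blast
  ultimately have "{t. 0 \<le> t \<and> t *\<^sub>R u \<in> star_of f} = {0..f u}"
    by auto
  then show ?thesis
    using assms by (simp add: radial_def)
qed

lemma star_of_star_body:
  fixes f :: "real^'n \<Rightarrow> real"
  assumes f: "continuous_on (sphere 0 1) f" and pos: "\<And>u. norm u = 1 \<Longrightarrow> 0 \<le> f u"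
  shows "star_of f \<in> star_bodies"
proof -
  obtain e :: "real^'n" where e: "norm e = 1"
    using vector_choose_size[of 1] by auto
  let ?g = "\<lambda>p::real \<times> (real^'n). (fst p * f (snd p)) *\<^sub>R snd p"
  have eq: "star_of f = ?g ` ({0..1} \<times> sphere 0 1)"
  proof
    show "star_of f \<subseteq> ?g ` ({0..1} \<times> sphere 0 1)"
    proof
      fix x assume "x \<in> star_of f"
      then obtain t u where x: "x = t *\<^sub>R u" "norm u = 1" "0 \<le> t" "t \<le> f u"
        by (auto simp: star_of_def)
      then have "x = ?g (t / f u, u)" "(t / f u, u) \<in> {0..1} \<times> sphere 0 1"
        by (auto simp: divide_simps)
      then show "x \<in> ?g ` ({0..1} \<times> sphere 0 1)" by blast
    qed
    show "?g ` ({0..1} \<times> sphere 0 1) \<subseteq> star_of f"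
      unfolding star_of_def using pos by (force simp: mult_left_le_one_le)
  qed
  have "continuous_on ({0..1} \<times> sphere 0 1) ?g"
    by (intro continuous_intros continuous_on_compose2[OF f]) auto
  then have "compact (star_of f)"
    unfolding eq by (intro compact_continuous_image compact_Times) auto
  moreover have "0 \<in> star_of f"
    unfolding star_of_def using e pos[OF e] by (auto intro!: exI[of _ 0] exI[of _ e])
  moreover have "closed_segment 0 x \<subseteq> star_of f" if x: "x \<in> star_of f" for x
  proof
    fix y assume "y \<in> closed_segment 0 x"
    then obtain c where c: "0 \<le> c" "c \<le> 1" "y = c *\<^sub>R x"
      by (auto simp: in_segment)
    obtain t u where t: "x = t *\<^sub>R u" "norm u = 1" "0 \<le> t" "t \<le> f u"
      using x by (auto simp: star_of_def)
    have "c * t \<le> f u" using c t by (meson mult_left_le_one_le order_trans)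
    then show "y \<in> star_of f"
      unfolding star_of_def using c t by (auto intro!: exI[of _ "c * t"] exI[of _ u])
  qed
  moreover have "continuous_on (sphere 0 1) (radial (star_of f))"
    using f by (rule continuous_on_eq) (simp add: radial_star_of[OF pos])
  ultimately show ?thesis by (simp add: star_bodies_iff)
qed

text \<open>The radial Hausdorff metric: uniform distance of the radial functions.
  It is not the Hausdorff metric of the underlying compact sets, whose topology on
  star bodies is strictly coarser. (Bodies whose radial functions oscillate ever faster
  between 1 and 2 converge to the ball of radius 2 in the latter, but not in the former.)
  The operator with \<open>radial (\<Psi> L) = (radial L) ^ (n - 1)\<close> is a
  radial Blaschke Minkowski homomorphism for either metric, but the operator it induces on
  \<open>(n - 1)\<close>-tuples, with the product of the radial functions, is jointly continuous only
  for the radial one.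
  The value 0 off \<open>star_bodies\<close> only makes the function total.\<close>

definition radial_dist :: "(real^'n) set \<Rightarrow> (real^'n) set \<Rightarrow> real" where
  "radial_dist K L = (if K \<in> star_bodies \<and> L \<in> star_bodies
     then SUP u\<in>sphere 0 1. \<bar>radial K u - radial L u\<bar> else 0)"

definition star_topology :: "(real^'n) set topology" where
  "star_topology = Metric_space.mtopology star_bodies radial_dist"

lemma sphere_nonempty: "sphere (0 :: real^'n) 1 \<noteq> {}"
  using vector_choose_size[of 1, where 'a = "real^'n"] by auto

lemma radial_dist_upper:
  assumes "K \<in> star_bodies" "L \<in> star_bodies" "norm u = 1"
  shows "\<bar>radial K u - radial L u\<bar> \<le> radial_dist K L"
proof -
  have "continuous_on (sphere 0 1) (\<lambda>u. \<bar>radial K u - radial L u\<bar>)"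
    using assms by (intro continuous_intros) (auto simp: star_bodies_iff)
  then have "compact ((\<lambda>u. \<bar>radial K u - radial L u\<bar>) ` sphere 0 1)"
    by (intro compact_continuous_image) auto
  then have "bdd_above ((\<lambda>u. \<bar>radial K u - radial L u\<bar>) ` sphere 0 1)"
    by (simp add: bounded_imp_bdd_above compact_imp_bounded)
  then show ?thesis
    using assms by (auto simp: radial_dist_def intro!: cSUP_upper)
qed

lemma radial_dist_le:
  fixes K L :: "(real^'n) set"
  assumes "K \<in> star_bodies" "L \<in> star_bodies"
    and "\<And>u. norm u = 1 \<Longrightarrow> \<bar>radial K u - radial L u\<bar> \<le> c"
  shows "radial_dist K L \<le> c"
  using assms sphere_nonempty by (auto simp: radial_dist_def intro!: cSUP_least)

lemma star_body_eqI:
  assumes "K \<in> star_bodies" "L \<in> star_bodies"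
    and "\<And>u. norm u = 1 \<Longrightarrow> radial K u = radial L u"
  shows "K = L"
proof -
  have "star_of (radial K) = star_of (radial L)"
    unfolding star_of_def using assms(3) by metis
  then show ?thesis using assms star_of_radial by metis
qed

interpretation star: Metric_space "star_bodies :: (real^'n) set set" radial_dist
  rewrites "Metric_space.mtopology star_bodies radial_dist = (star_topology :: (real^'n) set topology)"
proof -
  show "Metric_space (star_bodies :: (real^'n) set set) radial_dist"
  proof
    fix K L M :: "(real^'n) set"
    obtain e :: "real^'n" where e: "norm e = 1"
      using vector_choose_size[of 1] by auto
    show "0 \<le> radial_dist K L"
    proof (cases "K \<in> star_bodies \<and> L \<in> star_bodies")
      case True
      then show ?thesis using radial_dist_upper[of K L e] e by linarith
    next
      case False
      then show ?thesis by (simp only: radial_dist_def if_False)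
    qed
    show "radial_dist K L = radial_dist L K"
      by (auto simp: radial_dist_def abs_minus_commute)
    show "radial_dist K L = 0 \<longleftrightarrow> K = L" if KL: "K \<in> star_bodies" "L \<in> star_bodies"
    proof
      assume "radial_dist K L = 0"
      then show "K = L"
        using radial_dist_upper[OF KL] by (intro star_body_eqI[OF KL]) force
    qed (use sphere_nonempty in \<open>simp add: radial_dist_def\<close>)
    show "radial_dist K M \<le> radial_dist K L + radial_dist L M"
      if KLM: "K \<in> star_bodies" "L \<in> star_bodies" "M \<in> star_bodies"
    proof (rule radial_dist_le[OF KLM(1,3)])
      fix u :: "real^'n" assume u: "norm u = 1"
      show "\<bar>radial K u - radial M u\<bar> \<le> radial_dist K L + radial_dist L M"
        using radial_dist_upper[OF KLM(1,2) u] radial_dist_upper[OF KLM(2,3) u] by linarith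
    qed
  qed
qed (simp add: star_topology_def)

lemma topspace_star_topology [simp]: "topspace star_topology = star_bodies"
  by (rule star.topspace_mtopology)

definition radial_comb :: "'i set \<Rightarrow> ('i \<Rightarrow> real) \<Rightarrow> ('i \<Rightarrow> (real^'n) set) \<Rightarrow> (real^'n) set" where
  "radial_comb I c L = star_of (\<lambda>u. \<Sum>i\<in>I. c i * radial (L i) u)"

definition radial_sum :: "(real^'n) set \<Rightarrow> (real^'n) set \<Rightarrow> (real^'n) set" where
  "radial_sum K L = star_of (\<lambda>u. radial K u + radial L u)"

definition radial_Blaschke_sum :: "(real^'n) set \<Rightarrow> (real^'n) set \<Rightarrow> (real^'n) set" where
  "radial_Blaschke_sum K L =
     star_of (\<lambda>u. root (CARD('n) - 1) (radial K u ^ (CARD('n) - 1) + radial L u ^ (CARD('n) - 1)))"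

definition radial_Blaschke_Minkowski_hom :: "((real^'n) set \<Rightarrow> (real^'n) set) \<Rightarrow> bool" where
  "radial_Blaschke_Minkowski_hom \<Psi> \<longleftrightarrow>
     continuous_map star_topology star_topology \<Psi> \<and>
     (\<forall>K\<in>star_bodies. \<forall>L\<in>star_bodies.
        \<Psi> (radial_Blaschke_sum K L) = radial_sum (\<Psi> K) (\<Psi> L)) \<and>
     (\<forall>L\<in>star_bodies. \<forall>Q::real^'n^'n. rotation_matrix Q \<longrightarrow>
        \<Psi> ((\<lambda>x. Q *v x) ` L) = (\<lambda>x. Q *v x) ` \<Psi> L)"

lemma radial_comb_star_body:
  fixes L :: "'i \<Rightarrow> (real^'n) set"
  assumes "\<And>i. i \<in> I \<Longrightarrow> L i \<in> star_bodies" "\<And>i. i \<in> I \<Longrightarrow> 0 \<le> c i"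
  shows "radial_comb I c L \<in> star_bodies"
    and "norm u = 1 \<Longrightarrow> radial (radial_comb I c L) u = (\<Sum>i\<in>I. c i * radial (L i) u)"
proof -
  have pos: "0 \<le> (\<Sum>i\<in>I. c i * radial (L i) u)" if "norm u = 1" for u
    using assms that radial_attained(1) by (intro sum_nonneg mult_nonneg_nonneg) auto
  show "radial_comb I c L \<in> star_bodies"
    unfolding radial_comb_def using assms pos
    by (intro star_of_star_body continuous_intros) (auto simp: star_bodies_iff)
  show "norm u = 1 \<Longrightarrow> radial (radial_comb I c L) u = (\<Sum>i\<in>I. c i * radial (L i) u)"
    unfolding radial_comb_def using pos by (intro radial_star_of) auto
qed

lemma radial_sum_star_body:
  fixes K L :: "(real^'n) set"
  assumes "K \<in> star_bodies" "L \<in> star_bodies"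
  shows "radial_sum K L \<in> star_bodies"
    and "norm u = 1 \<Longrightarrow> radial (radial_sum K L) u = radial K u + radial L u"
proof -
  have pos: "0 \<le> radial K u + radial L u" if "norm u = 1" for u
    using assms that radial_attained(1) by (intro add_nonneg_nonneg) auto
  show "radial_sum K L \<in> star_bodies"
    unfolding radial_sum_def using assms pos
    by (intro star_of_star_body continuous_intros) (auto simp: star_bodies_iff)
  show "norm u = 1 \<Longrightarrow> radial (radial_sum K L) u = radial K u + radial L u"
    unfolding radial_sum_def using pos by (intro radial_star_of) auto
qed

lemma radial_Blaschke_sum_star_body:
  fixes K L :: "(real^'n) set"
  assumes "K \<in> star_bodies" "L \<in> star_bodies" and n: "2 \<le> CARD('n)"
  shows "radial_Blaschke_sum K L \<in> star_bodies"
    and "norm u = 1 \<Longrightarrow> radial (radial_Blaschke_sum K L) u ^ (CARD('n) - 1) =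
       radial K u ^ (CARD('n) - 1) + radial L u ^ (CARD('n) - 1)"
proof -
  let ?k = "CARD('n) - 1"
  have pos: "0 \<le> radial K u ^ ?k + radial L u ^ ?k" if "norm u = 1" for u
    using assms that radial_attained(1) by (intro add_nonneg_nonneg zero_le_power) auto
  have rpos: "0 \<le> root ?k (radial K u ^ ?k + radial L u ^ ?k)" if "norm u = 1" for u
    using pos[OF that] by (rule real_root_ge_zero)
  show "radial_Blaschke_sum K L \<in> star_bodies"
    unfolding radial_Blaschke_sum_def using assms rpos
    by (intro star_of_star_body continuous_intros) (auto simp: star_bodies_iff)
  show "radial (radial_Blaschke_sum K L) u ^ ?k = radial K u ^ ?k + radial L u ^ ?k"
    if u: "norm u = 1"
  proof -
    have "radial (radial_Blaschke_sum K L) u = root ?k (radial K u ^ ?k + radial L u ^ ?k)"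
      unfolding radial_Blaschke_sum_def by (rule radial_star_of) (use rpos u in auto)
    then show ?thesis
      using pos[OF u] n by (simp add: real_root_pow_pos2)
  qed
qed

end

theory Submission
  imports Defs
begin

text \<open>Write \<open>\<Psi> L = T (\<rho>\<^sub>L ^ (n - 1))\<close>, where \<open>\<rho>\<^sub>L\<close> is the radial function and \<open>T\<close> maps
  nonnegative continuous functions on the sphere to radial functions. The Blaschke homomorphism
  property says that \<open>T\<close> is additive; since \<open>T\<close> takes nonnegative values, it is monotone, hence
  commutes with nonnegative real factors. So \<open>\<Phi> (L\<^sub>1, \<dots>, L\<^bsub>n-1\<^esub>) = T (\<rho>\<^sub>1 \<cdots> \<rho>\<^bsub>n-1\<^esub>)\<close>
  is the polarization of \<open>\<Psi>\<close>: expand the product \<open>(\<Sum>i. a\<^sub>i \<rho>\<^sub>i) ^ (n - 1)\<close> and apply \<open>T\<close> termwise.\<close>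

section \<open>Radial functions and uniform convergence\<close>

lemma star_of_cong:
  assumes "\<And>u. norm u = 1 \<Longrightarrow> f u = g u"
  shows "star_of f = star_of g"
  unfolding star_of_def using assms by metis

lemma bounded_radial_image:
  assumes "L \<in> star_bodies"
  shows "bounded (radial L ` sphere 0 1)"
  using assms by (auto simp: star_bodies_iff intro!: compact_imp_bounded compact_continuous_image)

text \<open>The metric is the supremum distance of radial functions, so its balls are uniform
  neighbourhoods. This turns continuity into \<open>star_topology\<close> from any space, product
  topologies included, into a statement about uniform limits, which are stable under products and
  composition.\<close>

lemma continuous_map_star_topology_iff:
  fixes F :: "'a \<Rightarrow> (real^'n) set"
  shows "continuous_map X star_topology F \<longleftrightarrow> F \<in> topspace X \<rightarrow> star_bodies \<and>
    (\<forall>x\<in>topspace X. uniform_limit (sphere 0 1) (\<lambda>y. radial (F y)) (radial (F x)) (nhdsin X x))"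
    (is "?C \<longleftrightarrow> ?B \<and> ?U")
proof -
  have "uniform_limit (sphere 0 1) (\<lambda>y. radial (F y)) (radial (F x)) (nhdsin X x) \<longleftrightarrow>
      (\<forall>e>0. \<exists>V. openin X V \<and> x \<in> V \<and> (\<forall>y\<in>V. F y \<in> star.mball (F x) e))"
    (is "?L \<longleftrightarrow> ?R") if F: ?B and x: "x \<in> topspace X" for x
  proof
    assume L: ?L
    show ?R
    proof (intro allI impI)
      fix e :: real assume e: "0 < e"
      \<comment> \<open>Strict pointwise bounds give only a non-strict bound on the supremum;
        starting from \<open>e / 2\<close> restores the strict inequality that the ball
        demands.\<close>
      from uniform_limitD[OF L, of "e / 2"] e obtain V where V: "openin X V" "x \<in> V"
        "\<And>y u. y \<in> V \<Longrightarrow> norm u = 1 \<Longrightarrow> \<bar>radial (F y) u - radial (F x) u\<bar> < e / 2"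
        using x by (auto simp: eventually_nhdsin dist_real_def)
      have "F y \<in> star.mball (F x) e" if y: "y \<in> V" for y
      proof -
        have mem: "F y \<in> star_bodies" "F x \<in> star_bodies"
          using F x y openin_subset[OF V(1)] by auto
        have "radial_dist (F y) (F x) \<le> e / 2"
          using V(3)[OF y] by (intro radial_dist_le mem less_imp_le)
        then show ?thesis using mem e by (simp add: star.in_mball star.commute)
      qed
      with V show "\<exists>V. openin X V \<and> x \<in> V \<and> (\<forall>y\<in>V. F y \<in> star.mball (F x) e)"
        by blast
    qed
  next
    assume R: ?R
    show ?L
    proof (rule uniform_limitI)
      fix e :: real assume "0 < e"
      with R obtain V where V: "openin X V" "x \<in> V" "\<And>y. y \<in> V \<Longrightarrow> F y \<in> star.mball (F x) e"
        by metis
      have "\<bar>radial (F y) u - radial (F x) u\<bar> < e" if "y \<in> V" "norm u = 1" for y u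
        using V(3)[OF that(1)] radial_dist_upper[OF _ _ that(2), of "F y" "F x"]
        by (force simp: star.in_mball star.commute)
      then show "\<forall>\<^sub>F y in nhdsin X x. \<forall>u\<in>sphere 0 1. dist (radial (F y) u) (radial (F x) u) < e"
        using V by (auto simp: eventually_nhdsin dist_real_def)
    qed
  qed
  moreover have ?B if ?C
    using continuous_map_funspace[OF that] by simp
  ultimately show ?thesis
    unfolding star.continuous_map_to_metric by blast
qed

section \<open>Additivity and nonnegative homogeneity of \<open>T\<close>\<close>

text \<open>Nonnegativity makes an additive function monotone, and monotonicity replaces continuity
  in Cauchy's functional equation. The deviation from linearity, multiplied by any natural number,
  stays below \<open>\<phi> 1\<close>, so it vanishes by the Archimedean property.\<close>

lemma additive_nonneg_linear:
  fixes \<phi> :: "real \<Rightarrow> real"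
  assumes add: "\<And>s t. 0 \<le> s \<Longrightarrow> 0 \<le> t \<Longrightarrow> \<phi> (s + t) = \<phi> s + \<phi> t"
    and nonneg: "\<And>t. 0 \<le> t \<Longrightarrow> 0 \<le> \<phi> t"
    and t: "0 \<le> t"
  shows "\<phi> t = t * \<phi> 1"
proof -
  have mono: "\<phi> r \<le> \<phi> s" if "0 \<le> r" "r \<le> s" for r s
    using add[of r "s - r"] nonneg[of "s - r"] that by simp
  have zero: "\<phi> 0 = 0" using add[of 0 0] by simp
  have mult: "\<phi> (real m * s) = real m * \<phi> s" if "0 \<le> s" for m s
    by (induction m) (use that zero add in \<open>simp_all add: distrib_right\<close>)
  \<comment> \<open>With \<open>q\<close> the integer part of \<open>m * t\<close>, both
    \<open>m * \<phi> t\<close> and \<open>m * t * \<phi> 1\<close> lie between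
    \<open>q * \<phi> 1\<close> and \<open>(q + 1) * \<phi> 1\<close>, an interval of length
    \<open>\<phi> 1\<close> whatever \<open>m\<close> is.\<close>
  have "real m * \<bar>\<phi> t - t * \<phi> 1\<bar> \<le> \<phi> 1" for m
  proof -
    define q where "q = nat \<lfloor>real m * t\<rfloor>"
    have q: "real q \<le> real m * t" "real m * t \<le> real (Suc q)"
      using t unfolding q_def by (simp, simp) linarith
    have "\<phi> (real q * 1) \<le> \<phi> (real m * t)" "\<phi> (real m * t) \<le> \<phi> (real (Suc q) * 1)"
      using q t by (intro mono; simp)+
    then have "real q * \<phi> 1 \<le> real m * \<phi> t" "real m * \<phi> t \<le> real (Suc q) * \<phi> 1"
      using t by (simp_all only: mult zero_le_one)
    moreover have "real q * \<phi> 1 \<le> real m * t * \<phi> 1" "real m * t * \<phi> 1 \<le> real (Suc q) * \<phi> 1"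
      using q nonneg[of 1] by (intro mult_right_mono; simp)+
    ultimately have "\<bar>real m * \<phi> t - real m * t * \<phi> 1\<bar> \<le> \<phi> 1"
      by (simp add: algebra_simps abs_le_iff)
    moreover have "real m * \<phi> t - real m * t * \<phi> 1 = real m * (\<phi> t - t * \<phi> 1)"
      by (simp add: algebra_simps)
    ultimately show ?thesis by (simp add: abs_mult)
  qed
  then have "\<bar>\<phi> t - t * \<phi> 1\<bar> = 0"
    using reals_Archimedean3[of "\<bar>\<phi> t - t * \<phi> 1\<bar>"] by (metis abs_ge_zero not_le order_le_less)
  then show ?thesis by simp
qed

text \<open>\<open>T f = radial (\<Psi> (power_body f))\<close> is the operator \<open>T\<close> above.\<close>

definition power_body :: "(real^'n \<Rightarrow> real) \<Rightarrow> (real^'n) set" where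
  "power_body f = star_of (\<lambda>u. root (CARD('n) - 1) (f u))"

text \<open>This is the domain of \<open>T\<close>. Values off the unit sphere are left free, since
  \<open>star_of\<close> reads its argument only at unit vectors.\<close>

definition sphere_fun :: "(real^'n \<Rightarrow> real) \<Rightarrow> bool" where
  "sphere_fun f \<longleftrightarrow> continuous_on (sphere 0 1) f \<and> (\<forall>u. norm u = 1 \<longrightarrow> 0 \<le> f u)"

lemma sphere_fun_radial: "L \<in> star_bodies \<Longrightarrow> sphere_fun (radial L)"
  by (simp add: sphere_fun_def star_bodies_iff radial_attained(1))

lemma sphere_fun_add: "sphere_fun f \<Longrightarrow> sphere_fun g \<Longrightarrow> sphere_fun (\<lambda>u. f u + g u)"
  by (simp add: sphere_fun_def continuous_on_add)

lemma sphere_fun_cmult: "sphere_fun f \<Longrightarrow> 0 \<le> c \<Longrightarrow> sphere_fun (\<lambda>u. c * f u)"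
  by (simp add: sphere_fun_def continuous_on_mult_left)

lemma sphere_fun_sum: "(\<And>i. i \<in> I \<Longrightarrow> sphere_fun (f i)) \<Longrightarrow> sphere_fun (\<lambda>u. \<Sum>i\<in>I. f i u)"
  by (simp add: sphere_fun_def continuous_on_sum sum_nonneg)

lemma sphere_fun_prod: "(\<And>i. i \<in> I \<Longrightarrow> sphere_fun (f i)) \<Longrightarrow> sphere_fun (\<lambda>u. \<Prod>i\<in>I. f i u)"
  by (simp add: sphere_fun_def continuous_on_prod prod_nonneg)

lemma power_body_star_body:
  fixes f :: "real^'n \<Rightarrow> real"
  assumes f: "sphere_fun f"
  shows "power_body f \<in> star_bodies"
    and "norm u = 1 \<Longrightarrow> radial (power_body f) u = root (CARD('n) - 1) (f u)"
proof -
  have cont: "continuous_on (sphere 0 1) (\<lambda>u. root (CARD('n) - 1) (f u))"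
    using f by (intro continuous_intros) (simp add: sphere_fun_def)
  have nonneg: "0 \<le> root (CARD('n) - 1) (f v)" if "norm v = 1" for v
    using f that by (intro real_root_ge_zero) (simp add: sphere_fun_def)
  show "power_body f \<in> star_bodies"
    unfolding power_body_def by (intro star_of_star_body cont nonneg)
  show "norm u = 1 \<Longrightarrow> radial (power_body f) u = root (CARD('n) - 1) (f u)"
    unfolding power_body_def by (intro radial_star_of nonneg)
qed

text \<open>The powers in the Blaschke sum undo the roots in \<open>power_body\<close>, so Blaschke
  addition becomes pointwise addition. This is the source of the additivity of
  \<open>T\<close>.\<close>

lemma radial_Blaschke_sum_power_body:
  fixes f g :: "real^'n \<Rightarrow> real"
  assumes n: "2 \<le> CARD('n)" and fg: "sphere_fun f" "sphere_fun g"
  shows "radial_Blaschke_sum (power_body f) (power_body g) = power_body (\<lambda>u. f u + g u)"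
  unfolding radial_Blaschke_sum_def
  unfolding power_body_def[of "\<lambda>u. f u + g u"]
  using n fg
  by (intro star_of_cong) (simp add: power_body_star_body sphere_fun_def real_root_pow_pos2)

text \<open>Every star body is thus a \<open>power_body\<close>, so \<open>T\<close> determines
  \<open>\<Psi>\<close> completely.\<close>

lemma power_body_radial_power:
  fixes L :: "(real^'n) set"
  assumes "2 \<le> CARD('n)" "L \<in> star_bodies"
  shows "power_body (\<lambda>u. radial L u ^ (CARD('n) - 1)) = L"
proof -
  have "power_body (\<lambda>u. radial L u ^ (CARD('n) - 1)) = star_of (radial L)"
    unfolding power_body_def using assms
    by (intro star_of_cong) (simp add: real_root_power_cancel radial_attained(1))
  then show ?thesis by (simp add: star_of_radial assms)
qed

text \<open>At a fixed direction \<open>u\<close>, \<open>T\<close> is a real functional that is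
  additive and nonnegative. Along each ray of multiples of one function it is therefore linear, and
  induction on the index set gives finite combinations.\<close>

lemma radial_image_sum:
  fixes \<Psi> :: "(real^'n) set \<Rightarrow> (real^'n) set" and f :: "'i \<Rightarrow> real^'n \<Rightarrow> real"
  assumes n: "2 \<le> CARD('n)"
    and maps: "\<And>L. L \<in> star_bodies \<Longrightarrow> \<Psi> L \<in> star_bodies"
    and hom: "\<And>K L. K \<in> star_bodies \<Longrightarrow> L \<in> star_bodies \<Longrightarrow>
      \<Psi> (radial_Blaschke_sum K L) = radial_sum (\<Psi> K) (\<Psi> L)"
    and I: "finite I" and f: "\<And>i. i \<in> I \<Longrightarrow> sphere_fun (f i)" and c: "\<And>i. i \<in> I \<Longrightarrow> 0 \<le> c i"
    and u: "norm u = 1"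
  shows "radial (\<Psi> (power_body (\<lambda>v. \<Sum>i\<in>I. c i * f i v))) u =
    (\<Sum>i\<in>I. c i * radial (\<Psi> (power_body (f i))) u)"
proof -
  define T where "T g = radial (\<Psi> (power_body g)) u" for g :: "real^'n \<Rightarrow> real"
  have T_nonneg: "0 \<le> T g" if "sphere_fun g" for g
    unfolding T_def by (intro radial_attained maps power_body_star_body that u)
  have T_add: "T (\<lambda>v. g v + h v) = T g + T h" if gh: "sphere_fun g" "sphere_fun h" for g h
    unfolding T_def
    using hom[OF power_body_star_body(1)[OF gh(1)] power_body_star_body(1)[OF gh(2)]] gh
    by (simp add: radial_Blaschke_sum_power_body n radial_sum_star_body maps power_body_star_body u)
  have T_cmult: "T (\<lambda>v. t * g v) = t * T g" if g: "sphere_fun g" and t: "0 \<le> t" for g t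
  proof -
    \<comment> \<open>The factor \<open>1\<close> is kept so that the right side is the value at
      \<open>1\<close> of the function sending \<open>t\<close> to
      \<open>T (\<lambda>v. t * g v)\<close>.\<close>
    have "T (\<lambda>v. t * g v) = t * T (\<lambda>v. 1 * g v)"
    proof (rule additive_nonneg_linear[OF _ _ t])
      show "T (\<lambda>v. (r + s) * g v) = T (\<lambda>v. r * g v) + T (\<lambda>v. s * g v)"
        if "0 \<le> r" "0 \<le> s" for r s
        using T_add[OF sphere_fun_cmult[OF g that(1)] sphere_fun_cmult[OF g that(2)]]
        by (simp add: distrib_right)
    qed (intro T_nonneg sphere_fun_cmult g)
    then show ?thesis by simp
  qed
  have T_zero: "T (\<lambda>v. 0) = 0"
    using T_add[of "\<lambda>v. 0" "\<lambda>v. 0"] by (simp add: sphere_fun_def)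
  have "T (\<lambda>v. \<Sum>i\<in>I. c i * f i v) = (\<Sum>i\<in>I. c i * T (f i))"
    using I f c
  proof (induction I rule: finite_induct)
    case (insert i I)
    have "T (\<lambda>v. c i * f i v + (\<Sum>j\<in>I. c j * f j v)) = T (\<lambda>v. c i * f i v) + T (\<lambda>v. \<Sum>j\<in>I. c j * f j v)"
      using insert.prems by (intro T_add sphere_fun_cmult sphere_fun_sum) auto
    then show ?case using insert by (simp add: T_cmult)
  qed (simp add: T_zero)
  then show ?thesis by (simp add: T_def)
qed

section \<open>Joint continuity of the product construction\<close>

text \<open>Finite products preserve uniform convergence to bounded limits, and the root is
  uniformly continuous on a compact interval that eventually contains all the values.\<close>

lemma continuous_map_power_body_prod:
  fixes J :: "'j set"
  assumes J: "finite J"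
  shows "continuous_map (product_topology (\<lambda>_. star_topology) J) star_topology
    (\<lambda>L. power_body (\<lambda>u. \<Prod>j\<in>J. radial (L j) u) :: (real^'n) set)"
    (is "continuous_map ?X _ ?F")
  unfolding continuous_map_star_topology_iff
proof (intro conjI ballI)
  have sf: "sphere_fun (\<lambda>u. \<Prod>j\<in>J. radial (L j) u)" if "L \<in> topspace ?X" for L :: "'j \<Rightarrow> (real^'n) set"
    using that by (intro sphere_fun_prod sphere_fun_radial) auto
  then show "?F \<in> topspace ?X \<rightarrow> star_bodies"
    by (simp add: power_body_star_body)
  fix L :: "'j \<Rightarrow> (real^'n) set" assume L: "L \<in> topspace ?X"
  let ?k = "CARD('n) - 1" and ?G = "nhdsin ?X L"
  have ev_mem: "\<forall>\<^sub>F M in ?G. M \<in> topspace ?X"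
    unfolding eventually_nhdsin using openin_topspace L by blast
  \<comment> \<open>The induction runs over subsets \<open>I\<close> of \<open>J\<close>, because
    the product topology on \<open>J\<close>-tuples must stay fixed while factors are added.\<close>
  have lim: "uniform_limit (sphere 0 1) (\<lambda>M u. \<Prod>j\<in>I. radial (M j) u) (\<lambda>u. \<Prod>j\<in>I. radial (L j) u) ?G"
    if "I \<subseteq> J" for I
    using finite_subset[OF that J] that
  proof (induction I rule: finite_induct)
    case (insert i I)
    have "continuous_map ?X star_topology (\<lambda>M. M i)"
      using insert.prems by (intro continuous_map_product_projection) auto
    then have lim_i: "uniform_limit (sphere 0 1) (\<lambda>M. radial (M i)) (radial (L i)) ?G"
      using L by (simp add: continuous_map_star_topology_iff)
    have "bounded (radial (L i) ` sphere 0 1)"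
      using L insert.prems by (intro bounded_radial_image) auto
    moreover have "sphere_fun (\<lambda>u. \<Prod>j\<in>I. radial (L j) u)"
      using L insert.prems by (intro sphere_fun_prod sphere_fun_radial) auto
    then have "bounded ((\<lambda>u. \<Prod>j\<in>I. radial (L j) u) ` sphere 0 1)"
      by (intro compact_imp_bounded compact_continuous_image) (auto simp: sphere_fun_def)
    ultimately show ?case
      using uniform_lim_mult[OF lim_i insert.IH] insert by simp
  qed (simp add: uniform_limit_const)
  let ?p = "\<lambda>M u. \<Prod>j\<in>J. radial (M j :: (real^'n) set) u"
  have "bounded (?p L ` sphere 0 1)"
    using sf[OF L] by (intro compact_imp_bounded compact_continuous_image) (auto simp: sphere_fun_def)
  then obtain B where B: "\<And>u. norm u = 1 \<Longrightarrow> \<bar>?p L u\<bar> \<le> B"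
    by (force simp: bounded_iff)
  \<comment> \<open>The margin \<open>1\<close> above the bound \<open>B\<close> leaves room for the
    products of nearby tuples, which eventually differ from the limit by less than
    \<open>1\<close>.\<close>
  have uc: "uniformly_continuous_on {0..B + 1} (root ?k)"
    by (intro compact_uniformly_continuous continuous_intros) auto
  have "\<forall>\<^sub>F M in ?G. \<forall>u\<in>sphere 0 1. dist (?p M u) (?p L u) < 1"
    using uniform_limitD[OF lim[OF order_refl]] by simp
  then have "\<forall>\<^sub>F M in ?G. ?p M ` sphere 0 1 \<subseteq> {0..B + 1}"
    using ev_mem
  proof eventually_elim
    case (elim M)
    have "0 \<le> ?p M u \<and> ?p M u \<le> B + 1" if u: "norm u = 1" for u
    proof -
      have "0 \<le> ?p M u" using sf[OF elim(2)] u by (simp add: sphere_fun_def)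
      moreover have "\<bar>?p M u - ?p L u\<bar> < 1" using elim(1) u by (simp add: dist_real_def)
      ultimately show ?thesis using B[OF u] by linarith
    qed
    then show ?case by auto
  qed
  moreover have "?p L ` sphere 0 1 \<subseteq> {0..B + 1}"
    using sf[OF L] B by (force simp: sphere_fun_def)
  ultimately have root_lim: "uniform_limit (sphere 0 1) (\<lambda>M u. root ?k (?p M u)) (root ?k \<circ> ?p L) ?G"
    by (intro uniform_limit_compose[OF lim[OF order_refl] uc])
  have ev_radial: "\<forall>\<^sub>F M in ?G. \<forall>u\<in>sphere 0 1. root ?k (?p M u) = radial (?F M) u"
    using ev_mem by eventually_elim (simp add: power_body_star_body sf)
  have radial_L: "(root ?k \<circ> ?p L) u = radial (?F L) u" if "u \<in> sphere 0 1" for u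
    using that by (simp add: power_body_star_body sf[OF L])
  show "uniform_limit (sphere 0 1) (\<lambda>M. radial (?F M)) (radial (?F L)) ?G"
    by (rule iffD1[OF uniform_limit_cong[OF ev_radial radial_L] root_lim])
qed

section \<open>Polarization of the homomorphism\<close>

theorem theorem1:
  fixes \<Psi> :: "(real^'n) set \<Rightarrow> (real^'n) set"
  assumes "3 \<le> CARD('n)"
    and "radial_Blaschke_Minkowski_hom \<Psi>"
    and nontrivial: "\<not> (\<forall>L\<in>star_bodies. \<Psi> L = {0})"
  shows "\<exists>\<Phi> :: (nat \<Rightarrow> (real^'n) set) \<Rightarrow> (real^'n) set.
    continuous_map (product_topology (\<lambda>_. star_topology) {1..CARD('n) - 1}) star_topology \<Phi> \<and>
    (\<forall>L \<in> {1..CARD('n) - 1} \<rightarrow>\<^sub>E star_bodies. \<forall>\<pi>. \<pi> permutes {1..CARD('n) - 1} \<longrightarrow>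
       \<Phi> (L \<circ> \<pi>) = \<Phi> L) \<and>
    (\<forall>m::nat. \<forall>L :: nat \<Rightarrow> (real^'n) set. \<forall>a :: nat \<Rightarrow> real.
       1 \<le> m \<and> (\<forall>i\<in>{1..m}. L i \<in> star_bodies \<and> 0 \<le> a i) \<longrightarrow>
       \<Psi> (radial_comb {1..m} a L) =
         radial_comb ({1..CARD('n) - 1} \<rightarrow>\<^sub>E {1..m})
           (\<lambda>\<iota>. \<Prod>j\<in>{1..CARD('n) - 1}. a (\<iota> j))
           (\<lambda>\<iota>. \<Phi> (\<lambda>j\<in>{1..CARD('n) - 1}. L (\<iota> j))))"
proof -
  let ?N = "{1..CARD('n) - 1}"
  have n: "2 \<le> CARD('n)" using assms(1) by simp
  have cont: "continuous_map star_topology star_topology \<Psi>"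
    and hom: "\<And>K L. K \<in> star_bodies \<Longrightarrow> L \<in> star_bodies \<Longrightarrow>
      \<Psi> (radial_Blaschke_sum K L) = radial_sum (\<Psi> K) (\<Psi> L)"
    using assms(2) by (auto simp: radial_Blaschke_Minkowski_hom_def)
  have maps: "\<Psi> L \<in> star_bodies" if "L \<in> star_bodies" for L
    using continuous_map_image_subset_topspace[OF cont] that by auto
  define \<Phi> where "\<Phi> L = \<Psi> (power_body (\<lambda>u. \<Prod>j\<in>?N. radial (L j) u))" for L :: "nat \<Rightarrow> (real^'n) set"
  have "continuous_map (product_topology (\<lambda>_. star_topology) ?N) star_topology \<Phi>"
    using continuous_map_compose[OF continuous_map_power_body_prod[of ?N] cont]
    by (simp add: \<Phi>_def[abs_def] o_def)
  moreover have "\<Phi> (L \<circ> \<pi>) = \<Phi> L" if "\<pi> permutes ?N" for L \<pi>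
  proof -
    have "(\<Prod>j\<in>?N. radial (L (\<pi> j)) u) = (\<Prod>j\<in>?N. radial (L j) u)" for u
      using prod.permute[OF that, of "\<lambda>j. radial (L j) u"] by (simp add: o_def)
    then show ?thesis by (simp add: \<Phi>_def)
  qed
  moreover have "\<Psi> (radial_comb {1..m} a L) =
      radial_comb (?N \<rightarrow>\<^sub>E {1..m}) (\<lambda>\<iota>. \<Prod>j\<in>?N. a (\<iota> j)) (\<lambda>\<iota>. \<Phi> (\<lambda>j\<in>?N. L (\<iota> j)))"
    if La: "\<forall>i\<in>{1..m}. L i \<in> star_bodies \<and> 0 \<le> a i" for m and L :: "nat \<Rightarrow> (real^'n) set" and a
  proof -
    let ?I = "?N \<rightarrow>\<^sub>E {1..m}"
    let ?K = "radial_comb {1..m} a L"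
    let ?f = "\<lambda>\<iota> u. \<Prod>j\<in>?N. radial (L (\<iota> j)) u"
    have K: "?K \<in> star_bodies"
      using La by (intro radial_comb_star_body) auto
    have finI: "finite ?I" by (intro finite_PiE) auto
    have sf: "sphere_fun (?f \<iota>)" if "\<iota> \<in> ?I" for \<iota>
      using that La by (intro sphere_fun_prod sphere_fun_radial) (auto simp: PiE_iff)
    have a: "0 \<le> (\<Prod>j\<in>?N. a (\<iota> j))" if "\<iota> \<in> ?I" for \<iota>
      using that La by (intro prod_nonneg) (auto simp: PiE_iff)
    \<comment> \<open>The restricted tuple is \<open>undefined\<close> outside \<open>?N\<close>,
      but \<open>\<Phi>\<close> reads only the coordinates in \<open>?N\<close>.\<close>
    have \<Phi>: "\<Phi> (\<lambda>j\<in>?N. L (\<iota> j)) = \<Psi> (power_body (?f \<iota>))" for \<iota>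
      by (simp add: \<Phi>_def)
    have "radial ?K u ^ (CARD('n) - 1) = (\<Sum>\<iota>\<in>?I. (\<Prod>j\<in>?N. a (\<iota> j)) * ?f \<iota> u)"
      if u: "norm u = 1" for u
    proof -
      \<comment> \<open>The power is written as a product of \<open>CARD('n) - 1\<close> equal sums;
        distributing it picks one summand per factor, and \<open>\<iota>\<close> records these
        choices.\<close>
      have "radial ?K u ^ (CARD('n) - 1) = (\<Prod>j\<in>?N. \<Sum>i\<in>{1..m}. a i * radial (L i) u)"
        using La u by (subst radial_comb_star_body(2)) auto
      also have "\<dots> = (\<Sum>\<iota>\<in>?I. \<Prod>j\<in>?N. a (\<iota> j) * radial (L (\<iota> j)) u)"
        by (intro prod_sum_PiE) auto
      finally show ?thesis by (simp add: prod.distrib)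
    qed
    then have "power_body (\<lambda>u. \<Sum>\<iota>\<in>?I. (\<Prod>j\<in>?N. a (\<iota> j)) * ?f \<iota> u) =
        power_body (\<lambda>u. radial ?K u ^ (CARD('n) - 1))"
      unfolding power_body_def by (intro star_of_cong) simp
    then have Keq: "?K = power_body (\<lambda>u. \<Sum>\<iota>\<in>?I. (\<Prod>j\<in>?N. a (\<iota> j)) * ?f \<iota> u)"
      using power_body_radial_power[OF n K] by simp
    have mem: "\<Phi> (\<lambda>j\<in>?N. L (\<iota> j)) \<in> star_bodies" if "\<iota> \<in> ?I" for \<iota>
      unfolding \<Phi> by (intro maps power_body_star_body sf that)
    show ?thesis
    \<comment> \<open>Radial functions determine star bodies, so it suffices to compare them
      direction by direction, where \<open>T\<close> can be applied termwise to the expansion in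
      \<open>Keq\<close>.\<close>
    proof (rule star_body_eqI)
      fix u :: "real^'n" assume u: "norm u = 1"
      have "radial (\<Psi> ?K) u = (\<Sum>\<iota>\<in>?I. (\<Prod>j\<in>?N. a (\<iota> j)) * radial (\<Psi> (power_body (?f \<iota>))) u)"
        unfolding Keq by (rule radial_image_sum[OF n maps hom finI sf a u])
      also have "\<dots> = radial (radial_comb ?I (\<lambda>\<iota>. \<Prod>j\<in>?N. a (\<iota> j))
          (\<lambda>\<iota>. \<Phi> (\<lambda>j\<in>?N. L (\<iota> j)))) u"
        unfolding \<Phi>[symmetric] by (intro radial_comb_star_body(2)[symmetric] mem a u)
      finally show "radial (\<Psi> ?K) u = \<dots>" .
    qed (intro maps K radial_comb_star_body(1) mem a)+
  qed
  ultimately show ?thesis by blast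
qed

end
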